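(* Let $F\colon X\to Y\cup\{+\infty_Y\}$ and $G\colon X\to Z\cup\{+\infty_Z\}$ be proper mappings, $C\subset X$ nonempty, $A:=C\cap G^{-1}(-S)$, and assume $A\cap\operatorname{dom}F\neq\emptyset$. Let $\mathcal{A}_1,\mathcal{A}_2,\mathcal{A}_3$ be the sets attached to $(F;G,C)$ defined in the context. For $(L,y)\in\mathcal{L}(X,Y)\times Y$ consider the statements: $(\alpha)$ for every $x\in X$: $x\in C$ and $G(x)\in-S$ imply $F(x)-L(x)+y\notin-\operatorname{int}K$; $(\beta_1)$ there is $T\in\mathcal{L}_+(S,K)$ with $(F+I_C+T\circ G)^*(L)\subset Y$ and $\big(y-(F+I_C+T\circ G)^*(L)\big)\cap(-\operatorname{int}K)=\emptyset$; $(\beta_2)$ there are $L'\in\mathcal{L}(X,Y)$ and $T\in\mathcal{L}_+(S,K)$ with $F^*(L')\uplus(I_C+T\circ G)^*(L-L')\subset Y$ and $\big(y-F^*(L')-(I_C+T\circ G)^*(L-L')\big)\cap(-\operatorname{int}K)=\emptyset$; $(\beta_3)$ there are $L',L''\in\mathcal{L}(X,Y)$ and $T\in\mathcal{L}_+(S,K)$ with $F^*(L')\uplus I_C^*(L'')\uplus(T\circ G)^*(L-L'-L'')\subset Y$ and $\big(y-F^*(L')-I_C^*(L'')-(T\circ G)^*(L-L'-L'')\big)\cap(-\operatorname{int}K)=\emptyset$. Then for each $i\in\{1,2,3\}$ the following two statements are equivalent: $(\mathbf{a}_i)$ $\operatorname{epi}(F+I_A)^*=\mathcal{A}_i$; $(\mathbf{b}_i)$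 for every $(L,y)\in\mathcal{L}(X,Y)\times Y$, $(\alpha)\Longleftrightarrow(\beta_i)$.
   Context: **Spaces and order.** $X,Y,Z$ are locally convex Hausdorff topological vector spaces; $K\subset Y$ is a proper ($K\ne Y$) closed convex cone with $\operatorname{int}K\neq\emptyset$; $S\subset Z$ is a nonempty closed convex cone. In $Y$: $y_1<_K y_2$ iff $y_1-y_2\in-\operatorname{int}K$. $Y^\bullet:=Y\cup\{-\infty_Y,+\infty_Y\}$ with $-\infty_Y<_K y<_K+\infty_Y$ for all $y\in Y$ (and $-\infty_Y<_K+\infty_Y$). Conventions: $-(\pm\infty_Y)=\mp\infty_Y$; $(+\infty_Y)+y=+\infty_Y$ for $y\in Y\cup\{+\infty_Y\}$; $(-\infty_Y)+y=-\infty_Y$ for $y\in Y\cup\{-\infty_Y\}$; sums and differences of sets are elementwise. **Weak supremum.** For $M\subset Y^\bullet$, $\operatorname{WSup}M$ is the set of $\bar v\in Y^\bullet$ such that $\bar v\not<_K v$ for all $v\in M$ and, for every $\tilde v\in Y^\bullet$ with $\tilde v<_K\bar v$, there is $v\in M$ with $\tilde v<_K v$. **Set order and WS-sum.** For nonempty $M,N\subset Y^\bullet$, $M\preccurlyeq_K N$ means $v\not<_K u$ for all $u\in M$, $v\in N$. $\mathcal{P}_p(Y)$ is the collection of all $U\subset Y$ such that $Y=(U-\operatorname{int}K)\cup U\cup(U+\operatorname{int}K)$ with the three sets pairwise disjoint. For $U,V\in\mathcal{P}_p(Y)\cup\{\{+\infty_Y\}\}$, $U\uplus V:=\operatorname{WSup}(U+V)$,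 which again lies in $\mathcal{P}_p(Y)\cup\{\{+\infty_Y\}\}$; $\uplus$ is associative and commutative. **Mappings.** For $H\colon X\to Y\cup\{+\infty_Y\}$, $\operatorname{dom}H=\{x: H(x)\neq+\infty_Y\}$; $H$ is proper if $\operatorname{dom}H\ne\emptyset$ (similarly for $G$). $I_D(x)=0_Y$ if $x\in D$, $+\infty_Y$ otherwise. $\mathcal{L}(X,Y)$ is the space of continuous linear mappings $X\to Y$, and $\mathcal{L}_+(S,K):=\{T\in\mathcal{L}(Z,Y): T(S)\subset K\}$. $(T\circ G)(x):=+\infty_Y$ when $G(x)=+\infty_Z$. **Conjugates and epigraphs.** $H^*(L):=\operatorname{WSup}\{L(x)-H(x): x\in X\}$ for $L\in\mathcal{L}(X,Y)$; $\operatorname{dom}H^*:=\{L: H^*(L)\ne\{+\infty_Y\}\}$; $\operatorname{epi}H^*:=\{(L,y)\in\mathcal{L}(X,Y)\times Y: y\in H^*(L)+K\}$. The extended epigraph is $\mathfrak{E}\mathrm{pi}\,H^*:=\{(L,U)\in\mathcal{L}(X,Y)\times\mathcal{P}_p(Y): L\in\operatorname{dom}H^*,\ H^*(L)\preccurlyeq_K U\}$. For $\mathscr{M}_1,\mathscr{M}_2\subset\mathcal{L}(X,Y)\times\mathcal{P}_p(Y)$, $\mathscr{M}_1\boxplus\mathscr{M}_2:=\{(L_1+L_2,U_1\uplus U_2):(L_i,U_i)\in\mathscr{M}_i,\ U_1\uplus U_2\in\mathcal{P}_p(Y)\}$ (pairs with $U_1\uplus U_2=\{+\infty_Y\}$ are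 discarded); this operation is commutative and associative. For $\mathscr{M}\subset\mathcal{L}(X,Y)\times\mathcal{P}_p(Y)$, $\Psi(\mathscr{M}):=\bigcup_{(L,U)\in\mathscr{M}}\{L\}\times U\subset\mathcal{L}(X,Y)\times Y$. **The sets $\mathcal{A}_i$.** $$\mathcal{A}_1:=\Psi\Big(\bigcup_{T\in\mathcal{L}_+(S,K)}\mathfrak{E}\mathrm{pi}(F+I_C+T\circ G)^*\Big),$$ $$\mathcal{A}_2:=\Psi\Big(\mathfrak{E}\mathrm{pi}F^*\boxplus\bigcup_{T\in\mathcal{L}_+(S,K)}\mathfrak{E}\mathrm{pi}(I_C+T\circ G)^*\Big),$$ $$\mathcal{A}_3:=\Psi\Big(\mathfrak{E}\mathrm{pi}F^*\boxplus\mathfrak{E}\mathrm{pi}I_C^*\boxplus\bigcup_{T\in\mathcal{L}_+(S,K)}\mathfrak{E}\mathrm{pi}(T\circ G)^*\Big).$$ *)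

theory Defs
  imports "HOL-Analysis.Analysis" "HOL-Library.Function_Algebras"
begin

section \<open>Locally convex Hausdorff topological vector spaces\<close>

text \<open>The constant \<^const>\<open>convex\<close> cannot be used on the type parameter of a class specification,
  so its definition is written out; \<open>locally_convex_0\<close> below restates the axiom.\<close>

class locally_convex_space = real_vector + topological_ab_group_add + t2_space +
  assumes tendsto_scaleR_Pair: "LIM x (nhds a \<times>\<^sub>F nhds b). fst x *\<^sub>R snd x :> nhds (a *\<^sub>R b)"
    and locally_convex_0_raw:
      "\<lbrakk>open U; 0 \<in> U\<rbrakk> \<Longrightarrow> \<exists>V. open V \<and>
         (\<forall>x\<in>V. \<forall>y\<in>V. \<forall>u\<ge>0. \<forall>v\<ge>0. u + v = 1 \<longrightarrow> u *\<^sub>R x + v *\<^sub>R y \<in> V) \<and> 0 \<in> V \<and> V \<subseteq> U"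

lemma locally_convex_0:
  fixes U :: "'a::locally_convex_space set"
  assumes "open U" "0 \<in> U"
  shows "\<exists>V. open V \<and> convex V \<and> 0 \<in> V \<and> V \<subseteq> U"
  using locally_convex_0_raw[OF assms] unfolding convex_def .

instance real_normed_vector \<subseteq> locally_convex_space
proof
  show "LIM x (nhds a \<times>\<^sub>F nhds b). fst x *\<^sub>R snd x :> nhds (a *\<^sub>R b)" for a :: real and b :: 'a
    by (intro tendsto_scaleR filterlim_fst filterlim_snd)
  show "\<exists>V. open V \<and> (\<forall>x\<in>V. \<forall>y\<in>V. \<forall>u\<ge>0. \<forall>v\<ge>0. u + v = 1 \<longrightarrow> u *\<^sub>R x + v *\<^sub>R y \<in> V)
      \<and> 0 \<in> V \<and> V \<subseteq> U" if "open U" "0 \<in> U" for U :: "'a set"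
    unfolding convex_def[symmetric] using that by (metis centre_in_ball convex_ball openE open_ball)
qed

text \<open>The library has bounded linear maps between normed spaces only, so the space of continuous
  linear mappings is a set of functions, with the pointwise operations.\<close>

definition cont_linear :: "('a::locally_convex_space \<Rightarrow> 'b::locally_convex_space) set" where
  "cont_linear = {L. linear L \<and> continuous_on UNIV L}"

definition pos_maps :: "'z::locally_convex_space set \<Rightarrow> 'y::locally_convex_space set \<Rightarrow> ('z \<Rightarrow> 'y) set" where
  "pos_maps S K = {T \<in> cont_linear. T ` S \<subseteq> K}"


section \<open>The extended space\<close>

datatype 'a bullet = Neg_Inf | Val 'a | Pos_Inf

text \<open>The sum of the two infinities is not covered by the conventions; it is left undefined
  and never arises in the statement.\<close>

instantiation bullet :: (plus) plus
begin
fun plus_bullet :: "'a::plus bullet \<Rightarrow> 'a bullet \<Rightarrow> 'a bullet" where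
  "Val x + Val y = Val (x + y)"
| "Pos_Inf + Val y = Pos_Inf"
| "Val x + Pos_Inf = Pos_Inf"
| "Pos_Inf + Pos_Inf = Pos_Inf"
| "Neg_Inf + Val y = Neg_Inf"
| "Val x + Neg_Inf = Neg_Inf"
| "Neg_Inf + Neg_Inf = Neg_Inf"
| "Pos_Inf + Neg_Inf = undefined"
| "Neg_Inf + Pos_Inf = undefined"
instance ..
end

instantiation bullet :: (uminus) uminus
begin
fun uminus_bullet :: "'a::uminus bullet \<Rightarrow> 'a bullet" where
  "- Val x = Val (- x)"
| "- Pos_Inf = Neg_Inf"
| "- Neg_Inf = Pos_Inf"
instance ..
end

instantiation bullet :: ("{plus,uminus}") minus
begin
definition minus_bullet :: "'a::{plus,uminus} bullet \<Rightarrow> 'a bullet \<Rightarrow> 'a bullet" where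
  "u - v = u + (- v :: 'a bullet)"
instance ..
end

text \<open>Sums of sets are the elementwise ones of \<^theory>\<open>HOL-Library.Set_Algebras\<close>; the difference
  \<open>A - B\<close> of sets is set-theoretic in the library, so the elementwise one has its own notation.\<close>

definition set_minus :: "'a::minus set \<Rightarrow> 'a set \<Rightarrow> 'a set" (infixl "\<ominus>" 65) where
  "A \<ominus> B = {a - b | a b. a \<in> A \<and> b \<in> B}"

fun less_K :: "'y::locally_convex_space set \<Rightarrow> 'y bullet \<Rightarrow> 'y bullet \<Rightarrow> bool" where
  "less_K K (Val x) (Val y) \<longleftrightarrow> x - y \<in> uminus ` interior K"
| "less_K K Neg_Inf (Val y) \<longleftrightarrow> True"
| "less_K K (Val x) Pos_Inf \<longleftrightarrow> True"
| "less_K K Neg_Inf Pos_Inf \<longleftrightarrow> True"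
| "less_K K _ _ \<longleftrightarrow> False"

definition WSup :: "'y::locally_convex_space set \<Rightarrow> 'y bullet set \<Rightarrow> 'y bullet set" where
  "WSup K M = {v. (\<forall>w\<in>M. \<not> less_K K v w) \<and> (\<forall>u. less_K K u v \<longrightarrow> (\<exists>w\<in>M. less_K K u w))}"

definition preceq_K :: "'y::locally_convex_space set \<Rightarrow> 'y bullet set \<Rightarrow> 'y bullet set \<Rightarrow> bool" where
  "preceq_K K M N \<longleftrightarrow> (\<forall>u\<in>M. \<forall>v\<in>N. \<not> less_K K v u)"

definition P_p :: "'y::locally_convex_space set \<Rightarrow> 'y set set" where
  "P_p K = {U. UNIV = (U \<ominus> interior K) \<union> U \<union> (U + interior K) \<and>
               (U \<ominus> interior K) \<inter> U = {} \<and> (U \<ominus> interior K) \<inter> (U + interior K) = {} \<and>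
               U \<inter> (U + interior K) = {}}"

definition WS_sum :: "'y::locally_convex_space set \<Rightarrow> 'y bullet set \<Rightarrow> 'y bullet set \<Rightarrow> 'y bullet set" where
  "WS_sum K U V = WSup K (U + V)"


section \<open>Mappings, conjugates, epigraphs\<close>

text \<open>A mapping into \<open>Y \<union> {+\<infinity>}\<close> is a function into \<^typ>\<open>'y bullet\<close> that avoids \<^const>\<open>Neg_Inf\<close>.\<close>

definition dom_map :: "('x \<Rightarrow> 'y bullet) \<Rightarrow> 'x set" where
  "dom_map H = {x. H x \<noteq> Pos_Inf}"

definition proper_mapping :: "('x \<Rightarrow> 'y bullet) \<Rightarrow> bool" where
  "proper_mapping H \<longleftrightarrow> (\<forall>x. H x \<noteq> Neg_Inf) \<and> dom_map H \<noteq> {}"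

definition Ind :: "'x set \<Rightarrow> 'x \<Rightarrow> 'y::zero bullet" where
  "Ind D x = (if x \<in> D then Val 0 else Pos_Inf)"

definition comp_bullet :: "('z \<Rightarrow> 'y) \<Rightarrow> ('x \<Rightarrow> 'z bullet) \<Rightarrow> 'x \<Rightarrow> 'y bullet" where
  "comp_bullet T G = map_bullet T \<circ> G"

definition conjugate :: "'y::locally_convex_space set \<Rightarrow> ('x::locally_convex_space \<Rightarrow> 'y bullet) \<Rightarrow>
    ('x \<Rightarrow> 'y) \<Rightarrow> 'y bullet set" where
  "conjugate K H L = WSup K {Val (L x) - H x | x. x \<in> UNIV}"

definition dom_conjugate :: "'y::locally_convex_space set \<Rightarrow>
    ('x::locally_convex_space \<Rightarrow> 'y bullet) \<Rightarrow> ('x \<Rightarrow> 'y) set" where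
  "dom_conjugate K H = {L \<in> cont_linear. conjugate K H L \<noteq> {Pos_Inf}}"

definition epi_conjugate :: "'y::locally_convex_space set \<Rightarrow>
    ('x::locally_convex_space \<Rightarrow> 'y bullet) \<Rightarrow> (('x \<Rightarrow> 'y) \<times> 'y) set" where
  "epi_conjugate K H = {(L, y). L \<in> cont_linear \<and> Val y \<in> conjugate K H L + Val ` K}"

definition Epi_conjugate :: "'y::locally_convex_space set \<Rightarrow>
    ('x::locally_convex_space \<Rightarrow> 'y bullet) \<Rightarrow> (('x \<Rightarrow> 'y) \<times> 'y set) set" where
  "Epi_conjugate K H = {(L, U). L \<in> dom_conjugate K H \<and> U \<in> P_p K \<and>
     preceq_K K (conjugate K H L) (Val ` U)}"

text \<open>Requiring \<open>W \<in> P_p K\<close> discards the pairs whose WS-sum is \<open>{+\<infinity>}\<close>.\<close>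

definition box_sum :: "'y::locally_convex_space set \<Rightarrow>
    (('x::locally_convex_space \<Rightarrow> 'y) \<times> 'y set) set \<Rightarrow> (('x \<Rightarrow> 'y) \<times> 'y set) set \<Rightarrow>
    (('x \<Rightarrow> 'y) \<times> 'y set) set" where
  "box_sum K M1 M2 = {(L1 + L2, W) | L1 L2 U1 U2 W. (L1, U1) \<in> M1 \<and> (L2, U2) \<in> M2 \<and>
     W \<in> P_p K \<and> Val ` W = WS_sum K (Val ` U1) (Val ` U2)}"

definition Psi :: "(('x \<Rightarrow> 'y) \<times> 'y set) set \<Rightarrow> (('x \<Rightarrow> 'y) \<times> 'y) set" where
  "Psi M = (\<Union>(L, U)\<in>M. {L} \<times> U)"


section \<open>The sets and conditions attached to the system\<close>

definition feasible_set :: "'z::locally_convex_space set \<Rightarrow> ('x \<Rightarrow> 'z bullet) \<Rightarrow> 'x set \<Rightarrow> 'x set" where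
  "feasible_set S G C = C \<inter> G -` (Val ` uminus ` S)"

context
  fixes K :: "'y::locally_convex_space set" and S :: "'z::locally_convex_space set"
    and F :: "'x::locally_convex_space \<Rightarrow> 'y bullet" and G :: "'x \<Rightarrow> 'z bullet" and C :: "'x set"
begin

definition A1 :: "(('x \<Rightarrow> 'y) \<times> 'y) set" where
  "A1 = Psi (\<Union>T\<in>pos_maps S K. Epi_conjugate K (F + Ind C + comp_bullet T G))"

definition A2 :: "(('x \<Rightarrow> 'y) \<times> 'y) set" where
  "A2 = Psi (box_sum K (Epi_conjugate K F)
     (\<Union>T\<in>pos_maps S K. Epi_conjugate K (Ind C + comp_bullet T G)))"

definition A3 :: "(('x \<Rightarrow> 'y) \<times> 'y) set" where
  "A3 = Psi (box_sum K (box_sum K (Epi_conjugate K F) (Epi_conjugate K (Ind C)))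
     (\<Union>T\<in>pos_maps S K. Epi_conjugate K (comp_bullet T G)))"

definition alpha :: "('x \<Rightarrow> 'y) \<Rightarrow> 'y \<Rightarrow> bool" where
  "alpha L y \<longleftrightarrow> (\<forall>x. x \<in> C \<and> G x \<in> Val ` uminus ` S \<longrightarrow>
     F x - Val (L x) + Val y \<notin> Val ` uminus ` interior K)"

definition beta1 :: "('x \<Rightarrow> 'y) \<Rightarrow> 'y \<Rightarrow> bool" where
  "beta1 L y \<longleftrightarrow> (\<exists>T\<in>pos_maps S K.
     conjugate K (F + Ind C + comp_bullet T G) L \<subseteq> range Val \<and>
     ({Val y} \<ominus> conjugate K (F + Ind C + comp_bullet T G) L) \<inter> Val ` uminus ` interior K = {})"

definition beta2 :: "('x \<Rightarrow> 'y) \<Rightarrow> 'y \<Rightarrow> bool" where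
  "beta2 L y \<longleftrightarrow> (\<exists>L'\<in>cont_linear. \<exists>T\<in>pos_maps S K.
     WS_sum K (conjugate K F L') (conjugate K (Ind C + comp_bullet T G) (L - L')) \<subseteq> range Val \<and>
     ({Val y} \<ominus> conjugate K F L' \<ominus> conjugate K (Ind C + comp_bullet T G) (L - L'))
       \<inter> Val ` uminus ` interior K = {})"

definition beta3 :: "('x \<Rightarrow> 'y) \<Rightarrow> 'y \<Rightarrow> bool" where
  "beta3 L y \<longleftrightarrow> (\<exists>L'\<in>cont_linear. \<exists>L''\<in>cont_linear. \<exists>T\<in>pos_maps S K.
     WS_sum K (WS_sum K (conjugate K F L') (conjugate K (Ind C) L''))
       (conjugate K (comp_bullet T G) (L - L' - L'')) \<subseteq> range Val \<and>
     ({Val y} \<ominus> conjugate K F L' \<ominus> conjugate K (Ind C) L''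
        \<ominus> conjugate K (comp_bullet T G) (L - L' - L''))
       \<inter> Val ` uminus ` interior K = {})"

end

end

theory Submission
  imports Defs
begin

text \<open>
  The idea is to treat the sets in \<open>P_p K\<close> as Dedekind cuts of the ordered space \<open>Y\<close>.
  Call a nonempty \<open>B\<close> with \<open>B - int K = B\<close> a \<^emph>\<open>lower cut\<close>. A lower cut \<open>B \<noteq> Y\<close> has a rim, the
  points \<open>v \<notin> B\<close> with \<open>v - int K \<subseteq> B\<close>, and \<open>B \<mapsto> rim B\<close> and \<open>U \<mapsto> U - int K\<close> are mutually inverse
  bijections between the proper lower cuts and \<open>P_p K\<close> (\<open>rim_in_P_p\<close>, \<open>rim_minus_interior\<close>, \<open>P_p_cut\<close>).
  The improper cut \<open>B = Y\<close> stands for \<open>{+\<infinity>}\<close>. All the notions of the theorem then become simple: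

  \<^item> unless \<open>M \<subseteq> {-\<infinity>}\<close>, \<open>WSup M\<close> is the extended rim of the set of points strictly below some
    element of \<open>M\<close>, where \<open>Y\<close> has the extended rim \<open>{+\<infinity>}\<close> (\<open>WSup_eq_ext_rim\<close>), so the conjugate of a proper mapping at \<open>L\<close> is the extended rim of the lower
    cut \<open>B(L) = {L x - H x} - int K\<close> (\<open>conjugate_eq_ext_rim\<close>);
  \<^item> the WS-sum is the Minkowski sum of lower cuts (\<open>WS_sum_ext_rim\<close>);
  \<^item> the order \<open>\<preceq>\<close> between a conjugate and a set in \<open>P_p K\<close> is inclusion of cuts (\<open>Epi_conjugate_eq\<close>);
  \<^item> \<open>(L, y)\<close> lies in the epigraph of the conjugate iff \<open>y \<notin> B(L)\<close> (\<open>epi_conjugate_eq\<close>), because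
    \<open>rim B + K\<close> is the complement of \<open>B\<close> (\<open>rim_plus_K\<close>).

  Hence each of the sets \<open>A_i\<close> is of the form \<open>{(L, y). \<exists>B. (L, B) \<in> \<Phi>_i \<and> y \<notin> B}\<close> for an explicit family
  \<open>\<Phi>_i\<close> of pairs of a linear mapping and a lower cut (\<open>Psi_represented\<close>, \<open>represents_box_sum\<close>), and
  \<open>\<beta>_i L y\<close> says exactly \<open>\<exists>B. (L, B) \<in> \<Phi>_i \<and> y \<notin> B\<close> (\<open>notin_cut_iff\<close> and its versions for two and
  three summands). As \<open>\<alpha> L y\<close> says that \<open>(L, y)\<close> is in the epigraph on the left of \<open>(a_i)\<close>
  (\<open>alpha_iff_notin_conj_cut\<close>), both \<open>(a_i)\<close> and \<open>(b_i)\<close> state the equality of the same two sets.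

  The one analytic ingredient is that a line in the direction of an interior point of \<open>K\<close> meets the
  rim of every proper cut (\<open>line_meets_rim\<close>).
\<close>

section \<open>Elementwise sums and differences of sets\<close>

lemma set_minus_iff: "z \<in> A \<ominus> B \<longleftrightarrow> (\<exists>a\<in>A. \<exists>b\<in>B. z = a - b)"
  by (auto simp: set_minus_def)

lemma set_plus_iff: "z \<in> A + B \<longleftrightarrow> (\<exists>a\<in>A. \<exists>b\<in>B. z = a + b)"
  by (auto simp: set_plus_def)

lemma bex_set_minus: "(\<exists>x\<in>A \<ominus> B. P x) \<longleftrightarrow> (\<exists>a\<in>A. \<exists>b\<in>B. P (a - b))"
  unfolding set_minus_def by blast

lemma bex_set_plus: "(\<exists>x\<in>A + B. P x) \<longleftrightarrow> (\<exists>a\<in>A. \<exists>b\<in>B. P (a + b))"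
  unfolding set_plus_def by blast

lemma set_plus_minus_assoc: "(A + B) \<ominus> C = A + (B \<ominus> C)"
  for A B C :: "'a::ab_group_add set"
  by (simp add: set_eq_iff set_minus_iff set_plus_iff bex_set_minus bex_set_plus add_diff_eq)

lemma set_plus_minus_swap: "(A \<ominus> C) + B = A + (B \<ominus> C)"
  for A B C :: "'a::ab_group_add set"
  by (metis set_plus_minus_assoc add.commute)

lemma set_minus_minus: "A \<ominus> B \<ominus> C = A \<ominus> (B + C)"
  for A B C :: "'a::ab_group_add set"
  by (simp add: set_eq_iff set_minus_iff bex_set_minus bex_set_plus diff_diff_eq)

lemma set_plus_ne: "A \<noteq> {} \<Longrightarrow> B \<noteq> {} \<Longrightarrow> A + B \<noteq> {}"
  unfolding set_plus_def by blast

lemma set_minus_ne: "A \<noteq> {} \<Longrightarrow> B \<noteq> {} \<Longrightarrow> A \<ominus> B \<noteq> {}"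
  unfolding set_minus_def by blast

lemma set_plus_UNIV:
  fixes A B :: "'a::ab_group_add set"
  assumes "A = UNIV \<or> B = UNIV" "A \<noteq> {}" "B \<noteq> {}"
  shows "A + B = UNIV"
proof -
  have *: "UNIV + D = UNIV" if D: "D \<noteq> {}" for D :: "'a set"
  proof -
    obtain d where "d \<in> D" using D by blast
    then have "z \<in> UNIV + D" for z using set_plus_intro[of "z - d" UNIV d D] by simp
    then show ?thesis by blast
  qed
  show ?thesis using assms *[of A] *[of B] by (auto simp: add.commute)
qed

lemma translate_eq_plus: "(+) a ` B = {a} + B" for B :: "'a::ab_group_add set"
  by (auto simp: set_plus_def)

section \<open>The interior of a convex cone\<close>

lemma tendsto_scaleR_line: "((\<lambda>t. k + t *\<^sub>R y) \<longlongrightarrow> k + a *\<^sub>R y) (nhds a)"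
  for y k :: "'a::locally_convex_space"
proof -
  have "LIM t nhds a. (t, y) :> nhds a \<times>\<^sub>F nhds y"
    by (intro filterlim_Pair filterlim_ident tendsto_const)
  from filterlim_compose[OF tendsto_scaleR_Pair this]
  have "((\<lambda>t. t *\<^sub>R y) \<longlongrightarrow> a *\<^sub>R y) (nhds a)" by simp
  then show ?thesis by (intro tendsto_add tendsto_const)
qed

lemma continuous_on_scaleR_const: "continuous_on UNIV (\<lambda>y::'a::locally_convex_space. c *\<^sub>R y)"
proof -
  have "((\<lambda>y. c *\<^sub>R y) \<longlongrightarrow> c *\<^sub>R a) (nhds a)" for a :: 'a
  proof -
    have "LIM y nhds a. (c, y) :> nhds c \<times>\<^sub>F nhds a"
      by (intro filterlim_Pair filterlim_ident tendsto_const)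
    from filterlim_compose[OF tendsto_scaleR_Pair this] show ?thesis by simp
  qed
  then show ?thesis
    by (simp add: continuous_on_def tendsto_at_iff_tendsto_nhds)
qed

locale solid_convex_cone =
  fixes K :: "'y::locally_convex_space set"
  assumes convex_K: "convex K" and cone_K: "cone K"
    and interior_ne: "interior K \<noteq> {}"
begin

lemma in_K: "k \<in> interior K \<Longrightarrow> k \<in> K"
  using interior_subset by blast

lemma scaleR_interior:
  assumes "0 < c" "k \<in> interior K"
  shows "c *\<^sub>R k \<in> interior K"
proof (rule interiorI)
  let ?V = "(\<lambda>y. inverse c *\<^sub>R y) -` interior K"
  show "open ?V"
    by (rule open_vimage[OF open_interior continuous_on_scaleR_const])
  show "c *\<^sub>R k \<in> ?V" using assms by simp
  show "?V \<subseteq> K"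
  proof
    fix y assume "y \<in> ?V"
    then have "inverse c *\<^sub>R y \<in> K" using interior_subset by auto
    then have "c *\<^sub>R (inverse c *\<^sub>R y) \<in> K" using cone_K assms unfolding cone_def by (meson less_imp_le)
    then show "y \<in> K" using assms by simp
  qed
qed

lemma add_K: "a \<in> K \<Longrightarrow> b \<in> K \<Longrightarrow> a + b \<in> K"
  using convex_K cone_K convex_cone by blast

lemma add_interior:
  assumes "a \<in> K" "k \<in> interior K"
  shows "a + k \<in> interior K"
proof (rule interiorI)
  let ?V = "(\<lambda>y. y - a) -` interior K"
  show "open ?V" by (intro open_vimage open_interior continuous_intros)
  show "a + k \<in> ?V" using assms by simp
  show "?V \<subseteq> K"
  proof
    fix y assume "y \<in> ?V"
    then have "a + (y - a) \<in> K" using interior_subset assms by (intro add_K) auto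
    then show "y \<in> K" by simp
  qed
qed

lemma interior_absorbs:
  assumes "k \<in> interior K"
  obtains e where "0 < e" "k + e *\<^sub>R y \<in> interior K"
proof -
  have "\<forall>\<^sub>F t in nhds 0. k + t *\<^sub>R y \<in> interior K"
    using topological_tendstoD[OF tendsto_scaleR_line[of k y 0] open_interior, of K] assms by simp
  then obtain d where "0 < d" "\<And>t::real. dist t 0 < d \<Longrightarrow> k + t *\<^sub>R y \<in> interior K"
    unfolding eventually_nhds_metric by blast
  then show ?thesis by (intro that[of "d/2"]) auto
qed

text \<open>Points of the interior are order units: this is \<open>interior_absorbs\<close> multiplied by \<open>1/e\<close>.\<close>

lemma interior_dominates:
  assumes "k \<in> interior K"
  obtains t where "0 < t" "t *\<^sub>R k + y \<in> interior K"
proof -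
  obtain e where e: "0 < e" "k + e *\<^sub>R y \<in> interior K" using interior_absorbs[OF assms] .
  have "inverse e *\<^sub>R (k + e *\<^sub>R y) \<in> interior K" using e by (intro scaleR_interior) auto
  then show ?thesis using e by (intro that[of "inverse e"]) (auto simp: scaleR_add_right)
qed

lemma zero_in_K: "0 \<in> K"
proof -
  obtain k where "k \<in> K" using interior_ne interior_subset by blast
  then have "0 *\<^sub>R k \<in> K" using cone_K unfolding cone_def by blast
  then show ?thesis by simp
qed

lemma interior_plus_interior: "interior K + interior K = interior K"
proof
  show "interior K + interior K \<subseteq> interior K"
    using add_interior interior_subset[of K] unfolding set_plus_def by blast
  show "interior K \<subseteq> interior K + interior K"
  proof
    fix k assume "k \<in> interior K"
    then have "(1/2) *\<^sub>R k \<in> interior K" by (intro scaleR_interior) auto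
    moreover have "k = (1/2) *\<^sub>R k + (1/2) *\<^sub>R k" by (simp flip: scaleR_add_left)
    ultimately show "k \<in> interior K + interior K" unfolding set_plus_iff by blast
  qed
qed


section \<open>Lower cuts and their rims\<close>

definition cut :: "'y set \<Rightarrow> bool" where
  "cut B \<longleftrightarrow> B \<noteq> {} \<and> B \<ominus> interior K = B"

text \<open>For a cut \<open>B\<close> this is the part in \<open>Y\<close> of the weak supremum of \<open>B\<close>.\<close>

definition rim :: "'y set \<Rightarrow> 'y set" where
  "rim B = {v. v \<notin> B \<and> (\<forall>k\<in>interior K. v - k \<in> B)}"

lemma cut_down: "cut B \<Longrightarrow> b \<in> B \<Longrightarrow> k \<in> interior K \<Longrightarrow> b - k \<in> B"
  unfolding cut_def set_eq_iff set_minus_iff by blast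

lemma cut_up:
  assumes "cut B" "b \<in> B"
  obtains k where "k \<in> interior K" "b + k \<in> B"
proof -
  have "b \<in> B \<ominus> interior K" using assms by (simp add: cut_def)
  then obtain c k where "c \<in> B" "k \<in> interior K" "b = c - k" unfolding set_minus_iff by blast
  then show ?thesis using that by simp
qed

text \<open>Cuts are stable under subtraction of \<open>K\<close> and not only of its interior: move up inside \<open>B\<close>
  by some \<open>j \<in> int K\<close> first, then come down by \<open>k + j \<in> int K\<close>.\<close>

lemma cut_diff_K:
  assumes "cut B" "b \<in> B" "k \<in> K"
  shows "b - k \<in> B"
proof -
  obtain j where "j \<in> interior K" "b + j \<in> B" using cut_up assms by blast
  then have "(b + j) - (k + j) \<in> B" using assms by (intro cut_down add_interior)
  then show ?thesis by simp
qed

lemma cut_set_minus: "D \<noteq> {} \<Longrightarrow> cut (D \<ominus> interior K)"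
  by (simp add: cut_def set_minus_minus interior_plus_interior set_minus_ne interior_ne)

lemma cut_plus: "cut A \<Longrightarrow> cut B \<Longrightarrow> cut (A + B)"
  unfolding cut_def by (metis set_plus_minus_assoc set_plus_ne)

lemma cut_translate: "cut B \<Longrightarrow> cut ((+) a ` B)"
  unfolding cut_def translate_eq_plus by (metis set_plus_minus_assoc set_plus_ne insert_not_empty)

text \<open>On the line \<open>y + t k\<^sub>0\<close> the cut \<open>B\<close> is a downward closed set of parameters. It is nonempty and
  bounded above because \<open>k\<^sub>0\<close> is an order unit, and the point at its supremum is on the rim: it is not
  in \<open>B\<close> because cuts have no maximal points, and everything strictly below it lies below a point of
  the line that is in \<open>B\<close>.\<close>

lemma line_meets_rim:
  assumes B: "cut B" "B \<noteq> UNIV" and k0: "k0 \<in> interior K"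
  obtains r where "y + r *\<^sub>R k0 \<in> rim B"
proof -
  define T where "T = {t. y + t *\<^sub>R k0 \<in> B}"
  have down: "s \<in> T" if "t \<in> T" "s < t" for s t
  proof -
    have "(y + t *\<^sub>R k0) - (t - s) *\<^sub>R k0 \<in> B"
      using that B k0 by (intro cut_down scaleR_interior) (auto simp: T_def)
    then show ?thesis by (simp add: T_def algebra_simps)
  qed
  have "T \<noteq> {}"
  proof -
    obtain b where b: "b \<in> B" using B by (auto simp: cut_def)
    obtain t where "t *\<^sub>R k0 + (b - y) \<in> interior K" using interior_dominates[OF k0] .
    then have "b - (t *\<^sub>R k0 + (b - y)) \<in> B" using cut_down B b by blast
    then have "- t \<in> T" by (simp add: T_def)
    then show ?thesis by blast
  qed
  moreover have "bdd_above T"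
  proof -
    obtain c where c: "c \<notin> B" using B by auto
    obtain t where t: "t *\<^sub>R k0 + (y - c) \<in> interior K" using interior_dominates[OF k0] .
    have "t \<notin> T"
    proof
      assume "t \<in> T"
      then have "y + t *\<^sub>R k0 - (t *\<^sub>R k0 + (y - c)) \<in> B" using cut_down[OF B(1) _ t] unfolding T_def by blast
      then show False using c by simp
    qed
    then show ?thesis using down by (intro bdd_aboveI[of _ t]) (metis not_le)
  qed
  ultimately have sup: "\<And>t. t \<in> T \<Longrightarrow> t \<le> Sup T" "\<And>s. s < Sup T \<Longrightarrow> \<exists>t\<in>T. s < t"
    by (auto simp: cSup_upper less_cSup_iff)
  let ?r = "Sup T"
  have "y + ?r *\<^sub>R k0 \<notin> B"
  proof
    assume "y + ?r *\<^sub>R k0 \<in> B"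
    then obtain k where k: "k \<in> interior K" "y + ?r *\<^sub>R k0 + k \<in> B" using cut_up B by blast
    obtain e where e: "0 < e" "k + e *\<^sub>R (- k0) \<in> interior K" using interior_absorbs[OF k(1)] .
    have "(y + ?r *\<^sub>R k0 + k) - (k + e *\<^sub>R (- k0)) \<in> B" using cut_down B k e by blast
    then have "?r + e \<in> T" by (simp add: T_def algebra_simps)
    then show False using sup(1) e by fastforce
  qed
  moreover have "y + ?r *\<^sub>R k0 - k \<in> B" if k: "k \<in> interior K" for k
  proof -
    obtain e where e: "0 < e" "k + e *\<^sub>R (- k0) \<in> interior K" using interior_absorbs[OF k] .
    obtain t where "t \<in> T" "?r - e < t" using sup(2)[of "?r - e"] e by auto
    then have "?r - e \<in> T" using down by blast
    then have "(y + (?r - e) *\<^sub>R k0) - (k + e *\<^sub>R (- k0)) \<in> B" using cut_down B e by (auto simp: T_def)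
    then show ?thesis by (simp add: algebra_simps)
  qed
  ultimately have "y + ?r *\<^sub>R k0 \<in> rim B" by (simp add: rim_def)
  then show ?thesis using that by blast
qed

lemma rim_ne: "cut B \<Longrightarrow> B \<noteq> UNIV \<Longrightarrow> rim B \<noteq> {}"
  using line_meets_rim interior_ne by blast

text \<open>The three cases are the signs of the parameter at which the line through \<open>y\<close> meets the rim.\<close>

lemma rim_trichotomy:
  assumes "cut B" "B \<noteq> UNIV"
  shows "y \<in> rim B \<ominus> interior K \<or> y \<in> rim B \<or> y \<in> rim B + interior K"
proof -
  obtain k0 where k0: "k0 \<in> interior K" using interior_ne by blast
  obtain r where r: "y + r *\<^sub>R k0 \<in> rim B" using line_meets_rim[OF assms k0] .
  consider "0 < r" | "r = 0" | "0 < - r" by linarith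
  then show ?thesis
  proof cases
    case 1
    then have "y = (y + r *\<^sub>R k0) - r *\<^sub>R k0" "r *\<^sub>R k0 \<in> interior K" using k0 scaleR_interior by auto
    then show ?thesis using r unfolding set_minus_iff by blast
  next
    case 2
    then show ?thesis using r by simp
  next
    case 3
    then have "y = (y + r *\<^sub>R k0) + (- r) *\<^sub>R k0" "(- r) *\<^sub>R k0 \<in> interior K"
      using k0 scaleR_interior[of "- r"] by auto
    then show ?thesis using r unfolding set_plus_iff by blast
  qed
qed

lemma rim_plus_K_disjoint: "cut B \<Longrightarrow> v \<in> rim B \<Longrightarrow> k \<in> K \<Longrightarrow> v + k \<notin> B"
  using cut_diff_K[of B "v + k" k] by (auto simp: rim_def)

lemma rim_minus_interior:
  assumes "cut B" "B \<noteq> UNIV"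
  shows "rim B \<ominus> interior K = B"
proof
  show "rim B \<ominus> interior K \<subseteq> B" by (auto simp: set_minus_iff rim_def)
  show "B \<subseteq> rim B \<ominus> interior K"
  proof
    fix y assume "y \<in> B"
    then have "y \<notin> rim B" "y \<notin> rim B + interior K"
      using rim_plus_K_disjoint[OF assms(1) _ in_K] by (fastforce simp: rim_def, fastforce simp: set_plus_iff)
    then show "y \<in> rim B \<ominus> interior K" using rim_trichotomy[OF assms] by blast
  qed
qed

lemma rim_plus_K:
  assumes "cut B" "B \<noteq> UNIV"
  shows "rim B + K = - B"
proof
  show "rim B + K \<subseteq> - B" using rim_plus_K_disjoint[OF assms(1)] by (auto simp: set_plus_iff)
  show "- B \<subseteq> rim B + K"
  proof
    fix y assume "y \<in> - B"
    then have "y \<in> rim B \<or> y \<in> rim B + interior K"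
      using rim_trichotomy[OF assms] rim_minus_interior[OF assms] by blast
    then show "y \<in> rim B + K"
      using zero_in_K interior_subset[of K] unfolding set_plus_iff by (metis add.right_neutral subsetD)
  qed
qed

lemma rim_in_P_p:
  assumes "cut B" "B \<noteq> UNIV"
  shows "rim B \<in> P_p K"
proof -
  have "rim B \<inter> (rim B + interior K) = {}"
    by (force simp: set_plus_iff rim_def)
  moreover have "B \<inter> rim B = {}" by (auto simp: rim_def)
  moreover have "B \<inter> (rim B + interior K) = {}"
    using rim_plus_K_disjoint[OF assms(1) _ in_K] by (fastforce simp: set_plus_iff)
  moreover have "UNIV = B \<union> rim B \<union> (rim B + interior K)"
    using rim_trichotomy[OF assms] unfolding rim_minus_interior[OF assms] by auto
  ultimately show ?thesis
    unfolding P_p_def mem_Collect_eq rim_minus_interior[OF assms] by (intro conjI)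
qed

text \<open>The converse of \<open>rim_in_P_p\<close>: every set in \<open>P_p K\<close> is the rim of the proper cut below it. A point
  of \<open>U + int K\<close> is not on that rim since it has points of \<open>U\<close> strictly below it.\<close>

lemma P_p_cut:
  assumes "U \<in> P_p K"
  shows "cut (U \<ominus> interior K)" "U \<ominus> interior K \<noteq> UNIV" "rim (U \<ominus> interior K) = U"
proof -
  let ?B = "U \<ominus> interior K"
  have all: "y \<in> ?B \<or> y \<in> U \<or> y \<in> U + interior K" for y using assms by (auto simp: P_p_def)
  have disj: "?B \<inter> U = {}" using assms by (auto simp: P_p_def)
  have ne: "U \<noteq> {}" using all by (auto simp: set_minus_iff set_plus_iff)
  show "cut ?B" using ne by (rule cut_set_minus)
  show "?B \<noteq> UNIV" using disj ne by auto
  show "rim ?B = U"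
  proof
    show "U \<subseteq> rim ?B" using disj by (fastforce simp: rim_def set_minus_def)
    show "rim ?B \<subseteq> U"
    proof
      fix v assume v: "v \<in> rim ?B"
      have "v \<notin> U + interior K"
      proof
        assume "v \<in> U + interior K"
        then obtain u k where uk: "u \<in> U" "k \<in> interior K" "v = u + k" unfolding set_plus_iff by blast
        then have "v - k \<in> ?B" using v unfolding rim_def by blast
        then show False using uk disj by auto
      qed
      then show "v \<in> U" using all v by (auto simp: rim_def)
    qed
  qed
qed

text \<open>If \<open>a \<in> A\<close> is outside \<open>B\<close>, then \<open>a = v + k\<close> with \<open>v\<close> on the rim of \<open>B\<close>, and \<open>v = a - k \<in> A\<close>.\<close>

lemma rim_disjoint_cut_iff:
  assumes "cut A" "cut B" "B \<noteq> UNIV"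
  shows "rim B \<inter> A = {} \<longleftrightarrow> A \<subseteq> B"
proof
  assume disj: "rim B \<inter> A = {}"
  show "A \<subseteq> B"
  proof
    fix a assume a: "a \<in> A"
    show "a \<in> B"
    proof (rule ccontr)
      assume "a \<notin> B"
      then obtain v k where "v \<in> rim B" "k \<in> K" "a = v + k"
        using rim_plus_K[OF assms(2,3)] unfolding set_eq_iff set_plus_iff by blast
      then show False using cut_diff_K[OF assms(1) a, of k] disj by auto
    qed
  qed
qed (auto simp: rim_def)


section \<open>Weak suprema and WS-sums in terms of cuts\<close>

definition below :: "'y bullet set \<Rightarrow> 'y set" where
  "below M = {y. \<exists>v\<in>M. less_K K (Val y) v}"

text \<open>The rim of the improper cut is empty, whereas a set has the weak supremum \<open>{+\<infinity>}\<close> when every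
  point of \<open>Y\<close> is strictly below some element of it.\<close>

definition ext_rim :: "'y set \<Rightarrow> 'y bullet set" where
  "ext_rim B = (if B = UNIV then {Pos_Inf} else Val ` rim B)"

lemma less_K_Val: "less_K K (Val x) (Val y) \<longleftrightarrow> y - x \<in> interior K"
proof -
  have "x - y \<in> uminus ` interior K \<longleftrightarrow> - (x - y) \<in> interior K"
    by (metis image_iff minus_minus)
  then show ?thesis by simp
qed

declare less_K.simps(1) [simp del] less_K_Val [simp]

lemma below_Val: "below (Val ` U) = U \<ominus> interior K"
  unfolding below_def set_minus_def
  by auto (metis diff_diff_eq2 add_diff_cancel_left' diff_add_cancel, metis diff_diff_eq2 add_diff_cancel_left')

lemma below_Pos_Inf: "Pos_Inf \<in> M \<Longrightarrow> below M = UNIV"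
  by (force simp: below_def)

text \<open>The assumption excludes the two sets \<open>{}\<close> and \<open>{-\<infinity>}\<close>, whose weak supremum is \<open>{-\<infinity>}\<close>. It provides
  an element of \<open>M\<close> above \<open>-\<infinity>\<close>. So \<open>-\<infinity>\<close> is not in the weak supremum, and for the other candidates
  the condition on smaller points is satisfied at \<open>-\<infinity>\<close>.\<close>

lemma WSup_eq_ext_rim:
  assumes "below M \<noteq> {}"
  shows "WSup K M = ext_rim (below M)"
proof -
  obtain w where w: "w \<in> M" "w \<noteq> Neg_Inf"
    using assms by (force simp: below_def)
  then have neg: "less_K K Neg_Inf w" by (cases w) auto
  have all_bullet: "(\<forall>u. P u) \<longleftrightarrow> P Neg_Inf \<and> P Pos_Inf \<and> (\<forall>y. P (Val y))" for P :: "'y bullet \<Rightarrow> bool"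
    by (metis bullet.exhaust)
  have down: "(\<forall>y. v - y \<in> interior K \<longrightarrow> y \<in> below M) \<longleftrightarrow> (\<forall>k\<in>interior K. v - k \<in> below M)" for v
    by (metis diff_diff_eq2 add_diff_cancel_left')
  have "Neg_Inf \<notin> WSup K M" using w neg by (auto simp: WSup_def)
  moreover have "Val v \<in> WSup K M \<longleftrightarrow> v \<in> rim (below M)" for v
  proof -
    have "Val v \<in> WSup K M \<longleftrightarrow> v \<notin> below M \<and> (\<forall>y. v - y \<in> interior K \<longrightarrow> y \<in> below M)"
      using w neg by (auto simp: WSup_def all_bullet below_def)
    then show ?thesis unfolding down by (simp add: rim_def)
  qed
  moreover have "Pos_Inf \<in> WSup K M \<longleftrightarrow> below M = UNIV"
    using w neg by (auto simp: WSup_def all_bullet below_def)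
  moreover have "rim UNIV = {}" by (simp add: rim_def)
  ultimately have "v \<in> WSup K M \<longleftrightarrow> v \<in> ext_rim (below M)" for v
    by (cases v) (auto simp: ext_rim_def)
  then show ?thesis by blast
qed

lemma below_ext_rim: "cut B \<Longrightarrow> below (ext_rim B) = B"
  by (simp add: ext_rim_def below_Pos_Inf below_Val rim_minus_interior)

lemma Val_plus_Val: "Val ` A + Val ` B = Val ` (A + B)"
  unfolding set_plus_def by (force simp: image_iff)

lemma Val_minus_Val: "Val ` A \<ominus> Val ` B = Val ` (A \<ominus> B)"
  for A B :: "'y set"
  unfolding set_minus_def by (force simp: image_iff minus_bullet_def)

text \<open>Subtracting \<open>int K\<close> turns one rim into its cut; this cut absorbs a further \<open>int K\<close>, which
  turns the other rim into its cut.\<close>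

lemma rim_plus_rim_minus_interior:
  assumes "cut A" "cut B" "A \<noteq> UNIV" "B \<noteq> UNIV"
  shows "(rim A + rim B) \<ominus> interior K = A + B"
proof -
  have "(rim A + rim B) \<ominus> interior K = rim A + (B \<ominus> interior K)"
    using assms by (simp add: set_plus_minus_assoc rim_minus_interior cut_def)
  also have "\<dots> = A + B"
    unfolding set_plus_minus_swap[symmetric] using assms by (simp add: rim_minus_interior)
  finally show ?thesis .
qed

text \<open>If one of the cuts is \<open>Y\<close>, the sum on the left contains \<open>+\<infinity>\<close>, in accordance with \<open>Y + B = Y\<close>.\<close>

lemma below_ext_rim_plus:
  assumes A: "cut A" and B: "cut B"
  shows "below (ext_rim A + ext_rim B) = A + B"
proof (cases "A = UNIV \<or> B = UNIV")
  case True
  have "Pos_Inf \<in> ext_rim A + ext_rim B"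
  proof -
    have "\<exists>a\<in>ext_rim A. \<exists>b\<in>ext_rim B. a + b = Pos_Inf"
      using True rim_ne[OF A] rim_ne[OF B] by (auto simp: ext_rim_def)
    then show ?thesis unfolding set_plus_iff by metis
  qed
  moreover have "A + B = UNIV" using True A B by (simp add: set_plus_UNIV cut_def)
  ultimately show ?thesis by (simp add: below_Pos_Inf)
next
  case False
  then show ?thesis
    using assms by (simp add: ext_rim_def Val_plus_Val below_Val rim_plus_rim_minus_interior)
qed

lemma WS_sum_ext_rim:
  assumes "cut A" "cut B"
  shows "WS_sum K (ext_rim A) (ext_rim B) = ext_rim (A + B)"
proof -
  have "A + B \<noteq> {}" using cut_plus[OF assms] by (simp add: cut_def)
  then show ?thesis
    unfolding WS_sum_def by (simp add: WSup_eq_ext_rim below_ext_rim_plus[OF assms])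
qed

lemma ext_rim_subset_Val_iff: "ext_rim B \<subseteq> range Val \<longleftrightarrow> B \<noteq> UNIV"
  by (auto simp: ext_rim_def)

lemma minus_rim_disjoint_iff:
  "(Val ` ({y} \<ominus> U)) \<inter> Val ` uminus ` interior K = {} \<longleftrightarrow> y \<notin> U \<ominus> interior K"
proof -
  have "(Val ` ({y} \<ominus> U)) \<inter> Val ` uminus ` interior K = {} \<longleftrightarrow>
      (\<forall>u\<in>U. \<forall>k\<in>interior K. y - u \<noteq> - k)"
    unfolding set_minus_def by blast
  also have "\<dots> \<longleftrightarrow> y \<notin> U \<ominus> interior K"
    unfolding set_minus_iff by (metis add_uminus_conv_diff diff_eq_eq add.commute)
  finally show ?thesis .
qed


section \<open>Conjugates and epigraphs in terms of cuts\<close>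

text \<open>The lower cut whose extended rim is the conjugate of \<open>H\<close> at \<open>L\<close>.\<close>

definition conj_cut :: "('x::locally_convex_space \<Rightarrow> 'y bullet) \<Rightarrow> ('x \<Rightarrow> 'y) \<Rightarrow> 'y set" where
  "conj_cut H L = {L x - h | x h. H x = Val h} \<ominus> interior K"

lemma cut_conj_cut:
  assumes "proper_mapping H"
  shows "cut (conj_cut H L)"
proof -
  obtain x where x: "H x \<noteq> Pos_Inf" "H x \<noteq> Neg_Inf" using assms by (auto simp: proper_mapping_def dom_map_def)
  then obtain h where "H x = Val h" by (cases "H x") auto
  then show ?thesis unfolding conj_cut_def by (intro cut_set_minus) blast
qed

lemma conjugate_eq_ext_rim:
  assumes "proper_mapping H"
  shows "conjugate K H L = ext_rim (conj_cut H L)"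
proof -
  let ?M = "{Val (L x) - H x | x. x \<in> UNIV}"
  have fin: "H x \<noteq> Neg_Inf" for x using assms by (simp add: proper_mapping_def)
  have "less_K K (Val y) (Val (L x) - H x) \<longleftrightarrow> (\<exists>h. H x = Val h \<and> less_K K (Val y) (Val (L x - h)))"
    for x y
    using fin[of x] by (cases "H x") (auto simp: minus_bullet_def)
  then have "below ?M = below (Val ` {L x - h | x h. H x = Val h})"
    unfolding below_def by (auto simp del: less_K_Val) blast+
  then have "below ?M = conj_cut H L" by (simp add: below_Val conj_cut_def)
  moreover have "conj_cut H L \<noteq> {}" using cut_conj_cut[OF assms] by (simp add: cut_def)
  ultimately show ?thesis unfolding conjugate_def using WSup_eq_ext_rim[of ?M] by simp
qed

lemma epi_conjugate_eq:
  assumes "proper_mapping H"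
  shows "epi_conjugate K H = {(L, y). L \<in> cont_linear \<and> y \<notin> conj_cut H L}"
proof -
  have "Val y \<in> ext_rim B + Val ` K \<longleftrightarrow> y \<notin> B" if "cut B" for y B
  proof (cases "B = UNIV")
    case True
    then show ?thesis by (auto simp: ext_rim_def set_plus_iff)
  next
    case False
    then have "ext_rim B + Val ` K = Val ` (- B)"
      using that by (simp add: ext_rim_def Val_plus_Val rim_plus_K)
    then show ?thesis by auto
  qed
  then show ?thesis
    unfolding epi_conjugate_def using cut_conj_cut[OF assms] by (simp add: conjugate_eq_ext_rim[OF assms])
qed

text \<open>The order relation says that the rim \<open>U\<close> does not meet the cut of \<open>H\<close>. The inclusion also puts \<open>L\<close>
  into the domain of the conjugate, since \<open>U \<ominus> interior K\<close> is a proper cut.\<close>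

lemma Epi_conjugate_eq:
  assumes "proper_mapping H"
  shows "Epi_conjugate K H = {(L, U). L \<in> cont_linear \<and> U \<in> P_p K \<and> conj_cut H L \<subseteq> U \<ominus> interior K}"
proof -
  have "ext_rim B \<noteq> {Pos_Inf} \<and> preceq_K K (ext_rim B) (Val ` U) \<longleftrightarrow> B \<subseteq> U \<ominus> interior K"
    if B: "cut B" and U: "U \<in> P_p K" for B U
  proof (cases "B = UNIV")
    case True
    then show ?thesis using P_p_cut(2)[OF U] by (auto simp: ext_rim_def)
  next
    case False
    have "preceq_K K (ext_rim B) (Val ` U) \<longleftrightarrow> U \<inter> below (ext_rim B) = {}"
      by (auto simp: preceq_K_def below_def)
    also have "\<dots> \<longleftrightarrow> rim (U \<ominus> interior K) \<inter> B = {}"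
      using B by (simp add: below_ext_rim P_p_cut(3)[OF U])
    also have "\<dots> \<longleftrightarrow> B \<subseteq> U \<ominus> interior K"
      by (rule rim_disjoint_cut_iff[OF B P_p_cut(1,2)[OF U]])
    finally show ?thesis using False by (auto simp: ext_rim_def)
  qed
  then show ?thesis
    unfolding Epi_conjugate_def dom_conjugate_def using cut_conj_cut[OF assms]
    by (auto simp: conjugate_eq_ext_rim[OF assms])
qed

text \<open>How a set \<open>M\<close> of pairs in \<open>L(X,Y) \<times> P_p(Y)\<close> is determined, as far as \<open>Psi\<close> can see, by a family
  \<open>\<Phi>\<close> of pairs of a mapping and a cut: each member of \<open>M\<close> is bounded below by a cut of \<open>\<Phi>\<close> over the
  same mapping, and \<open>M\<close> contains the rims of the proper cuts of \<open>\<Phi>\<close> and their translates by \<open>K\<close>.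
  Asking that \<open>M\<close> contain the rims of all proper cuts larger than those in \<open>\<Phi>\<close> would hold for the
  extended epigraphs, but it need not survive \<open>box_sum\<close>: a cut that contains \<open>B1 + B2\<close> need not
  be the sum of cuts that contain \<open>B1\<close> and \<open>B2\<close>. Translates do survive, since the translation can be
  put on one summand, and they are enough to fill the complement of a cut.\<close>

definition represents ::
  "(('x::locally_convex_space \<Rightarrow> 'y) \<times> 'y set) set \<Rightarrow> (('x \<Rightarrow> 'y) \<times> 'y set) set \<Rightarrow> bool" where
  "represents M \<Phi> \<longleftrightarrow>
     (\<forall>L B. (L, B) \<in> \<Phi> \<longrightarrow> cut B) \<and>
     (\<forall>L U. (L, U) \<in> M \<longrightarrow> U \<in> P_p K \<and> (\<exists>B. (L, B) \<in> \<Phi> \<and> B \<subseteq> U \<ominus> interior K)) \<and>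
     (\<forall>L B k. (L, B) \<in> \<Phi> \<longrightarrow> k \<in> K \<longrightarrow> B \<noteq> UNIV \<longrightarrow> (L, rim ((+) k ` B)) \<in> M)"

lemma represents_cut: "represents M \<Phi> \<Longrightarrow> (L, B) \<in> \<Phi> \<Longrightarrow> cut B"
  by (simp add: represents_def)

lemma represents_P_p: "represents M \<Phi> \<Longrightarrow> (L, U) \<in> M \<Longrightarrow> U \<in> P_p K"
  by (simp add: represents_def)

lemma represents_lower:
  "represents M \<Phi> \<Longrightarrow> (L, U) \<in> M \<Longrightarrow> \<exists>B. (L, B) \<in> \<Phi> \<and> B \<subseteq> U \<ominus> interior K"
  by (simp add: represents_def)

lemma represents_attained:
  "represents M \<Phi> \<Longrightarrow> (L, B) \<in> \<Phi> \<Longrightarrow> k \<in> K \<Longrightarrow> B \<noteq> UNIV \<Longrightarrow> (L, rim ((+) k ` B)) \<in> M"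
  by (simp add: represents_def)

lemma representsI:
  assumes "\<And>L B. (L, B) \<in> \<Phi> \<Longrightarrow> cut B"
    and "\<And>L U. (L, U) \<in> M \<Longrightarrow> U \<in> P_p K"
    and "\<And>L U. (L, U) \<in> M \<Longrightarrow> \<exists>B. (L, B) \<in> \<Phi> \<and> B \<subseteq> U \<ominus> interior K"
    and "\<And>L B k. (L, B) \<in> \<Phi> \<Longrightarrow> k \<in> K \<Longrightarrow> B \<noteq> UNIV \<Longrightarrow> (L, rim ((+) k ` B)) \<in> M"
  shows "represents M \<Phi>"
  using assms by (simp add: represents_def)

lemma translate_ne_UNIV: "B \<noteq> UNIV \<Longrightarrow> (+) k ` B \<noteq> UNIV" for B :: "'y set"
proof
  assume "B \<noteq> UNIV" "(+) k ` B = UNIV"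
  then obtain c where "c \<notin> B" "k + c \<in> (+) k ` B" by blast
  then show False by auto
qed

lemma rim_translate: "rim ((+) a ` B) = (+) a ` rim B"
proof -
  have mem: "v \<in> (+) a ` A \<longleftrightarrow> v - a \<in> A" for v A
    by (auto simp: image_iff) (metis add.commute diff_add_cancel)
  have swap: "v - k - a = v - a - k" for v k by (simp add: algebra_simps)
  show ?thesis unfolding set_eq_iff mem rim_def mem_Collect_eq by (simp add: mem swap)
qed

text \<open>A point outside \<open>B\<close> is \<open>v + k\<close> with \<open>v\<close> on the rim and \<open>k \<in> K\<close>, so it lies on the rim of the
  translate of \<open>B\<close> by \<open>k\<close>.\<close>

lemma Psi_represented:
  assumes "represents M \<Phi>"
  shows "Psi M = {(L, y). \<exists>B. (L, B) \<in> \<Phi> \<and> y \<notin> B}"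
proof -
  have "\<exists>U. (L, U) \<in> M \<and> y \<in> U" if B: "(L, B) \<in> \<Phi>" "y \<notin> B" for L y B
  proof -
    have cut: "cut B" "B \<noteq> UNIV" using represents_cut[OF assms] B by auto
    then obtain v k where vk: "v \<in> rim B" "k \<in> K" "y = v + k"
      using rim_plus_K[OF cut] B(2) unfolding set_eq_iff set_plus_iff by blast
    then have "y \<in> rim ((+) k ` B)" unfolding rim_translate by (simp add: add.commute[of v])
    moreover have "(L, rim ((+) k ` B)) \<in> M" using represents_attained[OF assms B(1) vk(2) cut(2)] .
    ultimately show ?thesis by blast
  qed
  moreover have "\<exists>B. (L, B) \<in> \<Phi> \<and> y \<notin> B" if U: "(L, U) \<in> M" "y \<in> U" for L y U
  proof -
    obtain B where B: "U \<in> P_p K" "(L, B) \<in> \<Phi>" "B \<subseteq> U \<ominus> interior K"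
      using represents_P_p[OF assms U(1)] represents_lower[OF assms U(1)] by blast
    then have "y \<notin> B" using U P_p_cut(3)[OF B(1)] by (auto simp: rim_def)
    then show ?thesis using B by blast
  qed
  ultimately show ?thesis unfolding Psi_def by fast
qed

definition conj_cuts :: "('x::locally_convex_space \<Rightarrow> 'y bullet) \<Rightarrow> (('x \<Rightarrow> 'y) \<times> 'y set) set" where
  "conj_cuts H = (\<lambda>L. (L, conj_cut H L)) ` cont_linear"

lemma represents_Epi_conjugate:
  assumes "proper_mapping H"
  shows "represents (Epi_conjugate K H) (conj_cuts H)"
proof -
  have "(L, rim ((+) k ` conj_cut H L)) \<in> Epi_conjugate K H"
    if L: "L \<in> cont_linear" and k: "k \<in> K" and ne: "conj_cut H L \<noteq> UNIV" for L k
  proof -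
    let ?B = "conj_cut H L"
    have cut: "cut ?B" by (rule cut_conj_cut[OF assms])
    have cut': "cut ((+) k ` ?B)" "(+) k ` ?B \<noteq> UNIV"
      using cut ne using translate_ne_UNIV by (blast intro: cut_translate)+
    have "?B \<subseteq> (+) k ` ?B"
    proof
      fix b assume "b \<in> ?B"
      then have "b - k \<in> ?B" using cut_diff_K cut k by blast
      then show "b \<in> (+) k ` ?B" by (rule rev_image_eqI) simp
    qed
    then show ?thesis
      unfolding Epi_conjugate_eq[OF assms] using L rim_in_P_p[OF cut'] rim_minus_interior[OF cut'] by simp
  qed
  then show ?thesis
    using cut_conj_cut[OF assms]
    by (intro representsI) (auto simp: conj_cuts_def Epi_conjugate_eq[OF assms])
qed

lemma represents_UN:
  assumes "\<And>i. i \<in> I \<Longrightarrow> represents (M i) (\<Phi> i)"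
  shows "represents (\<Union>i\<in>I. M i) (\<Union>i\<in>I. \<Phi> i)"
proof (rule representsI)
  show "cut B" if "(L, B) \<in> (\<Union>i\<in>I. \<Phi> i)" for L B
    using that assms represents_cut by blast
  show "U \<in> P_p K" "\<exists>B. (L, B) \<in> (\<Union>i\<in>I. \<Phi> i) \<and> B \<subseteq> U \<ominus> interior K"
    if "(L, U) \<in> (\<Union>i\<in>I. M i)" for L U
    using that assms represents_P_p represents_lower by (metis UN_iff)+
  show "(L, rim ((+) k ` B)) \<in> (\<Union>i\<in>I. M i)"
    if "(L, B) \<in> (\<Union>i\<in>I. \<Phi> i)" "k \<in> K" "B \<noteq> UNIV" for L B k
    using that assms represents_attained by (metis UN_iff)
qed

text \<open>The sum \<open>\<Phi>1 + \<Phi>2\<close> is the elementwise sum of sets of pairs, hence adds the mappings and takes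
  Minkowski sums of the cuts. A sum of cuts that is all of \<open>Y\<close> corresponds to the pairs that
  \<open>box_sum\<close> discards.\<close>

lemma represents_box_sum:
  assumes 1: "represents M1 \<Phi>1" and 2: "represents M2 \<Phi>2"
  shows "represents (box_sum K M1 M2) (\<Phi>1 + \<Phi>2)"
proof -
  have mem: "(L, B) \<in> \<Phi>1 + \<Phi>2 \<longleftrightarrow>
      (\<exists>L1 B1 L2 B2. (L1, B1) \<in> \<Phi>1 \<and> (L2, B2) \<in> \<Phi>2 \<and> L = L1 + L2 \<and> B = B1 + B2)" for L B
    unfolding set_plus_iff by force
  have cuts: "cut B" if "(L, B) \<in> \<Phi>1 \<or> (L, B) \<in> \<Phi>2" for L B
    using that represents_cut 1 2 by blast
  have ext: "Val ` U = ext_rim (U \<ominus> interior K)" if "U \<in> P_p K" for U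
    using P_p_cut[OF that] by (simp add: ext_rim_def)
  have low: "\<exists>B. (L1 + L2, B) \<in> \<Phi>1 + \<Phi>2 \<and> B \<subseteq> W \<ominus> interior K"
    if M: "(L1, U1) \<in> M1" "(L2, U2) \<in> M2" and W: "W \<in> P_p K" "Val ` W = WS_sum K (Val ` U1) (Val ` U2)"
    for L1 L2 U1 U2 W
  proof -
    obtain B1 where B1: "U1 \<in> P_p K" "(L1, B1) \<in> \<Phi>1" "B1 \<subseteq> U1 \<ominus> interior K"
      using represents_P_p[OF 1 M(1)] represents_lower[OF 1 M(1)] by blast
    obtain B2 where B2: "U2 \<in> P_p K" "(L2, B2) \<in> \<Phi>2" "B2 \<subseteq> U2 \<ominus> interior K"
      using represents_P_p[OF 2 M(2)] represents_lower[OF 2 M(2)] by blast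
    let ?C1 = "U1 \<ominus> interior K" and ?C2 = "U2 \<ominus> interior K"
    have cut: "cut ?C1" "cut ?C2" using P_p_cut B1 B2 by auto
    have "Val ` W = ext_rim (?C1 + ?C2)"
      using W ext B1 B2 WS_sum_ext_rim[OF cut] by metis
    then have "below (Val ` W) = ?C1 + ?C2" using below_ext_rim[OF cut_plus[OF cut]] by simp
    then have "B1 + B2 \<subseteq> W \<ominus> interior K" using B1 B2 by (simp add: below_Val set_plus_mono2)
    then show ?thesis using B1 B2 mem by blast
  qed
  have up: "(L, rim ((+) k ` B)) \<in> box_sum K M1 M2"
    if LB: "(L, B) \<in> \<Phi>1 + \<Phi>2" and k: "k \<in> K" and ne: "B \<noteq> UNIV" for L B k
  proof -
    obtain L1 B1 L2 B2 where B: "(L1, B1) \<in> \<Phi>1" "(L2, B2) \<in> \<Phi>2" "L = L1 + L2" "B = B1 + B2"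
      using LB unfolding mem by (elim exE conjE)
    have cut: "cut B1" "cut B2" using cuts B by auto
    have ne': "B1 \<noteq> UNIV" "B2 \<noteq> UNIV" using ne B cut set_plus_UNIV[of B1 B2] by (auto simp: cut_def)
    \<comment> \<open>The first rim is left in place, the whole translation goes to the second one.\<close>
    let ?C2 = "(+) k ` B2"
    have C2: "cut ?C2" "?C2 \<noteq> UNIV" using cut ne' using translate_ne_UNIV by (blast intro: cut_translate)+
    have "(L1, rim ((+) 0 ` B1)) \<in> M1" using represents_attained[OF 1 B(1) zero_in_K ne'(1)] .
    then have M1: "(L1, rim B1) \<in> M1" by simp
    have M2: "(L2, rim ?C2) \<in> M2" using represents_attained[OF 2 B(2) k ne'(2)] .
    have sum: "B1 + ?C2 = (+) k ` B"
      unfolding B translate_eq_plus by (simp add: ac_simps)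
    have kB: "cut ((+) k ` B)" "(+) k ` B \<noteq> UNIV"
      using cut_translate[OF cut_plus[OF cut]] translate_ne_UNIV[OF ne] B(4) by simp_all
    have "Val ` rim ((+) k ` B) = WS_sum K (Val ` rim B1) (Val ` rim ?C2)"
      using WS_sum_ext_rim[OF cut(1) C2(1)] ne' C2 kB(2) by (simp add: ext_rim_def sum)
    then show ?thesis
      unfolding box_sum_def using M1 M2 rim_in_P_p[OF kB] B by blast
  qed
  show ?thesis
  proof (rule representsI)
    show "cut B" if "(L, B) \<in> \<Phi>1 + \<Phi>2" for L B
      using that cuts cut_plus unfolding mem by blast
    show "U \<in> P_p K" "\<exists>B. (L, B) \<in> \<Phi>1 + \<Phi>2 \<and> B \<subseteq> U \<ominus> interior K"
      if "(L, U) \<in> box_sum K M1 M2" for L U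
      using that low by (auto simp: box_sum_def)
  qed (rule up)
qed

text \<open>The next three lemmas decode the conditions \<open>\<beta>_i\<close>. The first conjunct says that the sum of the
  cuts is proper. Without it the second one would hold vacuously when a conjugate is \<open>{+\<infinity>}\<close>, since
  \<open>Val y - Pos_Inf = Neg_Inf\<close>; when all the conjugates are rims, the second conjunct says that \<open>y\<close> is
  not strictly below a sum of rim points.\<close>

lemma notin_cut_iff:
  assumes A: "cut A"
  shows "ext_rim A \<subseteq> range Val \<and> ({Val y} \<ominus> ext_rim A) \<inter> Val ` uminus ` interior K = {}
    \<longleftrightarrow> y \<notin> A"
proof (cases "A = UNIV")
  case False
  then have "{Val y} \<ominus> ext_rim A = Val ` ({y} \<ominus> rim A)"
    using Val_minus_Val[of "{y}"] by (simp add: ext_rim_def)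
  then show ?thesis
    using False A by (simp add: minus_rim_disjoint_iff ext_rim_subset_Val_iff rim_minus_interior)
qed (simp add: ext_rim_def image_iff)

lemma notin_cut_plus_iff:
  assumes A: "cut A" and B: "cut B"
  shows "WS_sum K (ext_rim A) (ext_rim B) \<subseteq> range Val \<and>
      ({Val y} \<ominus> ext_rim A \<ominus> ext_rim B) \<inter> Val ` uminus ` interior K = {}
    \<longleftrightarrow> y \<notin> A + B"
proof (cases "A + B = UNIV")
  case True
  then show ?thesis by (simp add: WS_sum_ext_rim[OF assms] ext_rim_subset_Val_iff)
next
  case False
  then have ne: "A \<noteq> UNIV" "B \<noteq> UNIV" using A B set_plus_UNIV[of A B] by (auto simp: cut_def)
  then have "{Val y} \<ominus> ext_rim A \<ominus> ext_rim B = Val ` ({y} \<ominus> (rim A + rim B))"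
    using Val_minus_Val[of "{y}"] by (simp add: ext_rim_def Val_minus_Val set_minus_minus)
  moreover have "(rim A + rim B) \<ominus> interior K = A + B"
    using A B ne by (rule rim_plus_rim_minus_interior)
  ultimately show ?thesis
    using False by (simp add: minus_rim_disjoint_iff WS_sum_ext_rim[OF assms] ext_rim_subset_Val_iff)
qed

lemma notin_cut_plus_plus_iff:
  assumes A: "cut A" and B: "cut B" and C: "cut C"
  shows "WS_sum K (WS_sum K (ext_rim A) (ext_rim B)) (ext_rim C) \<subseteq> range Val \<and>
      ({Val y} \<ominus> ext_rim A \<ominus> ext_rim B \<ominus> ext_rim C) \<inter> Val ` uminus ` interior K = {}
    \<longleftrightarrow> y \<notin> A + B + C"
proof (cases "A + B + C = UNIV")
  case True
  then show ?thesis by (simp add: WS_sum_ext_rim A B C cut_plus ext_rim_subset_Val_iff)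
next
  case False
  then have AB: "A + B \<noteq> UNIV" "C \<noteq> UNIV"
    using A B C cut_plus[OF A B] set_plus_UNIV[of "A + B" C] by (auto simp: cut_def)
  then have ne: "A \<noteq> UNIV" "B \<noteq> UNIV" using A B set_plus_UNIV[of A B] by (auto simp: cut_def)
  have "{Val y} \<ominus> ext_rim A \<ominus> ext_rim B \<ominus> ext_rim C = Val ` ({y} \<ominus> (rim A + rim B + rim C))"
    using ne AB Val_minus_Val[of "{y}"] by (simp add: ext_rim_def Val_minus_Val set_minus_minus)
  moreover have "(rim A + rim B + rim C) \<ominus> interior K = A + B + C"
  proof -
    have "(rim A + rim B + rim C) \<ominus> interior K = (rim A + rim B) + (C \<ominus> interior K)"
      using C AB by (simp add: set_plus_minus_assoc rim_minus_interior cut_def)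
    also have "\<dots> = A + B + C"
      unfolding set_plus_minus_swap[symmetric] using A B ne by (simp add: rim_plus_rim_minus_interior)
    finally show ?thesis .
  qed
  ultimately show ?thesis
    using False by (simp add: minus_rim_disjoint_iff WS_sum_ext_rim A B C cut_plus ext_rim_subset_Val_iff)
qed

text \<open>Both sides of the equivalence compare the set of pairs with \<open>\<alpha>\<close> with the set of pairs with \<open>\<beta>\<close>,
  the latter being \<open>Psi M\<close>.\<close>

lemma epi_eq_Psi_iff:
  assumes "represents M \<Phi>" "E = {(L, y). L \<in> cont_linear \<and> \<alpha> L y}"
    and "\<And>L B. (L, B) \<in> \<Phi> \<Longrightarrow> L \<in> cont_linear"
    and "\<And>L y. L \<in> cont_linear \<Longrightarrow> \<beta> L y \<longleftrightarrow> (\<exists>B. (L, B) \<in> \<Phi> \<and> y \<notin> B)"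
  shows "E = Psi M \<longleftrightarrow> (\<forall>L\<in>cont_linear. \<forall>y. \<alpha> L y \<longleftrightarrow> \<beta> L y)"
proof -
  have "Psi M = {(L, y). L \<in> cont_linear \<and> \<beta> L y}"
    unfolding Psi_represented[OF assms(1)] using assms(3,4) by blast
  then show ?thesis unfolding assms(2) by blast
qed

end


section \<open>The mappings of the constrained system\<close>

lemma plus_ne_Neg_Inf: "a \<noteq> Neg_Inf \<Longrightarrow> b \<noteq> Neg_Inf \<Longrightarrow> a + b \<noteq> Neg_Inf"
  by (cases a; cases b) auto

lemma plus_eq_Pos_Inf_iff:
  "a \<noteq> Neg_Inf \<Longrightarrow> b \<noteq> Neg_Inf \<Longrightarrow> a + b = Pos_Inf \<longleftrightarrow> a = Pos_Inf \<or> b = Pos_Inf"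
  by (cases a; cases b) auto

lemma proper_mapping_plus:
  "proper_mapping F \<Longrightarrow> proper_mapping H \<Longrightarrow> dom_map F \<inter> dom_map H \<noteq> {} \<Longrightarrow> proper_mapping (F + H)"
  unfolding proper_mapping_def dom_map_def
  by (auto simp: plus_ne_Neg_Inf plus_eq_Pos_Inf_iff)

lemma dom_map_plus:
  "proper_mapping F \<Longrightarrow> proper_mapping H \<Longrightarrow> dom_map (F + H) = dom_map F \<inter> dom_map H"
  unfolding proper_mapping_def dom_map_def by (auto simp: plus_eq_Pos_Inf_iff)

lemma dom_map_Ind: "dom_map (Ind D :: 'x \<Rightarrow> 'y::zero bullet) = D"
  by (auto simp: dom_map_def Ind_def)

lemma proper_mapping_Ind: "D \<noteq> {} \<Longrightarrow> proper_mapping (Ind D :: 'x \<Rightarrow> 'y::zero bullet)"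
  by (auto simp: proper_mapping_def dom_map_Ind Ind_def)

lemma map_bullet_eq_iff:
  "map_bullet f a = Pos_Inf \<longleftrightarrow> a = Pos_Inf" "map_bullet f a = Neg_Inf \<longleftrightarrow> a = Neg_Inf"
  by (cases a; simp)+

lemma dom_map_comp_bullet: "dom_map (comp_bullet T G) = dom_map G"
  by (auto simp: dom_map_def comp_bullet_def map_bullet_eq_iff)

lemma proper_mapping_comp_bullet: "proper_mapping G \<Longrightarrow> proper_mapping (comp_bullet T G)"
  unfolding proper_mapping_def dom_map_comp_bullet by (auto simp: comp_bullet_def map_bullet_eq_iff)

lemma cont_linear_add: "L \<in> cont_linear \<Longrightarrow> L' \<in> cont_linear \<Longrightarrow> L + L' \<in> cont_linear"
  by (auto simp: cont_linear_def plus_fun_def intro: linear_compose_add continuous_on_add)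

lemma cont_linear_diff: "L \<in> cont_linear \<Longrightarrow> L' \<in> cont_linear \<Longrightarrow> L - L' \<in> cont_linear"
  by (auto simp: cont_linear_def fun_diff_def intro: linear_compose_sub continuous_on_diff)

context solid_convex_cone
begin

text \<open>\<open>F x - L x + y \<in> -int K\<close> means \<open>y \<in> (L x - F x) - int K\<close>, and the feasible points with \<open>F x\<close> finite
  are the domain of \<open>F + Ind A\<close>.\<close>

lemma alpha_iff_notin_conj_cut:
  assumes F: "proper_mapping F"
  shows "alpha K S F G C L y \<longleftrightarrow> y \<notin> conj_cut (F + Ind (feasible_set S G C)) L"
proof -
  let ?A = "feasible_set S G C"
  have val: "F x - Val (L x) + Val y \<in> Val ` uminus ` interior K \<longleftrightarrow>
      (\<exists>h. F x = Val h \<and> L x - h - y \<in> interior K)" for x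
  proof (cases "F x")
    case (Val h)
    have "h - L x + y = (h + y) - L x" "L x - h - y = L x - (h + y)" by simp_all
    then have "h - L x + y \<in> uminus ` interior K \<longleftrightarrow> L x - h - y \<in> interior K"
      by (metis less_K.simps(1) less_K_Val)
    then show ?thesis using Val by (auto simp: minus_bullet_def)
  qed (use F in \<open>auto simp: minus_bullet_def proper_mapping_def\<close>)
  have sum: "(F + Ind ?A) x = Val h \<longleftrightarrow> x \<in> ?A \<and> F x = Val h" for x h
    using F by (cases "F x") (auto simp: Ind_def proper_mapping_def)
  have "y \<in> conj_cut (F + Ind ?A) L \<longleftrightarrow>
      (\<exists>x h. x \<in> ?A \<and> F x = Val h \<and> (\<exists>k\<in>interior K. y = L x - h - k))"
    unfolding conj_cut_def sum set_minus_iff by blast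
  also have "\<dots> \<longleftrightarrow> (\<exists>x h. x \<in> ?A \<and> F x = Val h \<and> L x - h - y \<in> interior K)"
  proof -
    have "(\<exists>k\<in>interior K. y = z - k) \<longleftrightarrow> z - y \<in> interior K" for z by force
    then show ?thesis by simp
  qed
  also have "\<dots> \<longleftrightarrow> \<not> alpha K S F G C L y"
    unfolding alpha_def val feasible_set_def by auto
  finally show ?thesis by blast
qed

end

section \<open>The equivalences\<close>

theorem theorem5p1:
  fixes K :: "'y::locally_convex_space set"
    and S :: "'z::locally_convex_space set"
    and F :: "'x::locally_convex_space \<Rightarrow> 'y bullet"
    and G :: "'x \<Rightarrow> 'z bullet"
    and C :: "'x set"
  assumes "closed K" "convex K" "cone K" "K \<noteq> UNIV" "interior K \<noteq> {}"
    and "S \<noteq> {}" "closed S" "convex S" "cone S"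
    and "proper_mapping F" "proper_mapping G"
    and "C \<noteq> {}"
    and "feasible_set S G C \<inter> dom_map F \<noteq> {}"
  shows "(epi_conjugate K (F + Ind (feasible_set S G C)) = A1 K S F G C \<longleftrightarrow>
            (\<forall>L\<in>cont_linear. \<forall>y. alpha K S F G C L y \<longleftrightarrow> beta1 K S F G C L y)) \<and>
         (epi_conjugate K (F + Ind (feasible_set S G C)) = A2 K S F G C \<longleftrightarrow>
            (\<forall>L\<in>cont_linear. \<forall>y. alpha K S F G C L y \<longleftrightarrow> beta2 K S F G C L y)) \<and>
         (epi_conjugate K (F + Ind (feasible_set S G C)) = A3 K S F G C \<longleftrightarrow>
            (\<forall>L\<in>cont_linear. \<forall>y. alpha K S F G C L y \<longleftrightarrow> beta3 K S F G C L y))"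
proof -
  interpret solid_convex_cone K
    using assms by unfold_locales auto
  let ?A = "feasible_set S G C" and ?P = "pos_maps S K"
  let ?E = "epi_conjugate K (F + Ind ?A)"
  note F = \<open>proper_mapping F\<close> and G = \<open>proper_mapping G\<close>
  \<comment> \<open>All the mappings whose conjugates occur are finite at a feasible point of the domain of \<open>F\<close>.\<close>
  have IC: "proper_mapping (Ind C :: 'x \<Rightarrow> 'y bullet)" using assms by (intro proper_mapping_Ind)
  obtain x0 where x0: "x0 \<in> ?A" "x0 \<in> dom_map F" using assms by blast
  then have x0': "x0 \<in> C" "x0 \<in> dom_map G" by (auto simp: feasible_set_def dom_map_def)
  have TG: "proper_mapping (comp_bullet T G)" for T :: "'z \<Rightarrow> 'y"
    using G by (rule proper_mapping_comp_bullet)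
  have FIA: "proper_mapping (F + Ind ?A)"
    using x0 F by (intro proper_mapping_plus proper_mapping_Ind) (auto simp: dom_map_Ind)
  have ICTG: "proper_mapping (Ind C + comp_bullet T G)" for T :: "'z \<Rightarrow> 'y"
    using x0' IC TG by (intro proper_mapping_plus) (auto simp: dom_map_Ind dom_map_comp_bullet)
  have FIC: "proper_mapping (F + Ind C)"
    using x0 x0' F IC by (intro proper_mapping_plus) (auto simp: dom_map_Ind)
  have FICTG: "proper_mapping (F + Ind C + comp_bullet T G)" for T :: "'z \<Rightarrow> 'y"
    using x0 x0' F IC FIC TG by (intro proper_mapping_plus)
      (auto simp: dom_map_plus[OF F IC] dom_map_Ind dom_map_comp_bullet)
  have E: "?E = {(L, y). L \<in> cont_linear \<and> alpha K S F G C L y}"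
    unfolding epi_conjugate_eq[OF FIA] alpha_iff_notin_conj_cut[OF F] ..

  have 1: "?E = A1 K S F G C \<longleftrightarrow>
      (\<forall>L\<in>cont_linear. \<forall>y. alpha K S F G C L y \<longleftrightarrow> beta1 K S F G C L y)"
    unfolding A1_def
  proof (rule epi_eq_Psi_iff[OF _ E])
    let ?\<Phi> = "\<Union>T\<in>?P. conj_cuts (F + Ind C + comp_bullet T G)"
    show "represents (\<Union>T\<in>?P. Epi_conjugate K (F + Ind C + comp_bullet T G)) ?\<Phi>"
      by (intro represents_UN represents_Epi_conjugate FICTG)
    show "L \<in> cont_linear" if "(L, B) \<in> ?\<Phi>" for L B
      using that by (auto simp: conj_cuts_def)
    show "beta1 K S F G C L y \<longleftrightarrow> (\<exists>B. (L, B) \<in> ?\<Phi> \<and> y \<notin> B)" if "L \<in> cont_linear" for L y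
      unfolding beta1_def conjugate_eq_ext_rim[OF FICTG] notin_cut_iff[OF cut_conj_cut[OF FICTG]]
      using that by (auto simp: conj_cuts_def)
  qed

  have 2: "?E = A2 K S F G C \<longleftrightarrow>
      (\<forall>L\<in>cont_linear. \<forall>y. alpha K S F G C L y \<longleftrightarrow> beta2 K S F G C L y)"
    unfolding A2_def
  proof (rule epi_eq_Psi_iff[OF _ E])
    let ?\<Phi> = "conj_cuts F + (\<Union>T\<in>?P. conj_cuts (Ind C + comp_bullet T G))"
    show "represents (box_sum K (Epi_conjugate K F)
        (\<Union>T\<in>?P. Epi_conjugate K (Ind C + comp_bullet T G))) ?\<Phi>"
      by (intro represents_box_sum represents_UN represents_Epi_conjugate F ICTG)
    have mem: "(L, B) \<in> ?\<Phi> \<longleftrightarrow> L \<in> cont_linear \<and> (\<exists>L'\<in>cont_linear. \<exists>T\<in>?P.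
        B = conj_cut F L' + conj_cut (Ind C + comp_bullet T G) (L - L'))" for L B
    proof
      assume "(L, B) \<in> ?\<Phi>"
      then obtain L1 L2 T where "L1 \<in> cont_linear" "L2 \<in> cont_linear" "T \<in> ?P" "L = L1 + L2"
          "B = conj_cut F L1 + conj_cut (Ind C + comp_bullet T G) L2"
        by (auto simp: set_plus_iff conj_cuts_def)
      then show "L \<in> cont_linear \<and> (\<exists>L'\<in>cont_linear. \<exists>T\<in>?P.
          B = conj_cut F L' + conj_cut (Ind C + comp_bullet T G) (L - L'))"
        by (metis cont_linear_add add_diff_cancel_left')
    next
      assume "L \<in> cont_linear \<and> (\<exists>L'\<in>cont_linear. \<exists>T\<in>?P.
          B = conj_cut F L' + conj_cut (Ind C + comp_bullet T G) (L - L'))"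
      then obtain L' T where L: "L \<in> cont_linear" "L' \<in> cont_linear" "T \<in> ?P"
        and B: "B = conj_cut F L' + conj_cut (Ind C + comp_bullet T G) (L - L')" by blast
      have "(L', conj_cut F L') + (L - L', conj_cut (Ind C + comp_bullet T G) (L - L')) \<in> ?\<Phi>"
        using L cont_linear_diff[of L L'] by (intro set_plus_intro) (auto simp: conj_cuts_def)
      then show "(L, B) \<in> ?\<Phi>" using B by simp
    qed
    show "L \<in> cont_linear" if "(L, B) \<in> ?\<Phi>" for L B
      using that unfolding mem by blast
    show "beta2 K S F G C L y \<longleftrightarrow> (\<exists>B. (L, B) \<in> ?\<Phi> \<and> y \<notin> B)" if "L \<in> cont_linear" for L y
      unfolding beta2_def conjugate_eq_ext_rim[OF F] conjugate_eq_ext_rim[OF ICTG]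
        notin_cut_plus_iff[OF cut_conj_cut[OF F] cut_conj_cut[OF ICTG]] mem
      using that by blast
  qed

  have 3: "?E = A3 K S F G C \<longleftrightarrow>
      (\<forall>L\<in>cont_linear. \<forall>y. alpha K S F G C L y \<longleftrightarrow> beta3 K S F G C L y)"
    unfolding A3_def
  proof (rule epi_eq_Psi_iff[OF _ E])
    let ?\<Phi> = "conj_cuts F + conj_cuts (Ind C) + (\<Union>T\<in>?P. conj_cuts (comp_bullet T G))"
    let ?B = "\<lambda>L L' L'' T. conj_cut F L' + conj_cut (Ind C) L'' + conj_cut (comp_bullet T G) (L - L' - L'')"
    show "represents (box_sum K (box_sum K (Epi_conjugate K F) (Epi_conjugate K (Ind C)))
        (\<Union>T\<in>?P. Epi_conjugate K (comp_bullet T G))) ?\<Phi>"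
      by (intro represents_box_sum represents_UN represents_Epi_conjugate F IC TG)
    have mem: "(L, B) \<in> ?\<Phi> \<longleftrightarrow> L \<in> cont_linear \<and>
        (\<exists>L'\<in>cont_linear. \<exists>L''\<in>cont_linear. \<exists>T\<in>?P. B = ?B L L' L'' T)" for L B
    proof
      assume "(L, B) \<in> ?\<Phi>"
      then obtain L1 L2 L3 T where L: "L1 \<in> cont_linear" "L2 \<in> cont_linear" "L3 \<in> cont_linear" "T \<in> ?P"
          "L = L1 + L2 + L3"
          "B = conj_cut F L1 + conj_cut (Ind C) L2 + conj_cut (comp_bullet T G) L3"
        by (auto simp: set_plus_iff conj_cuts_def)
      then have "L3 = L - L1 - L2" by (simp add: fun_eq_iff)
      then show "L \<in> cont_linear \<and>
          (\<exists>L'\<in>cont_linear. \<exists>L''\<in>cont_linear. \<exists>T\<in>?P. B = ?B L L' L'' T)"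
        using L by (metis cont_linear_add)
    next
      assume "L \<in> cont_linear \<and>
          (\<exists>L'\<in>cont_linear. \<exists>L''\<in>cont_linear. \<exists>T\<in>?P. B = ?B L L' L'' T)"
      then obtain L' L'' T where L: "L \<in> cont_linear" "L' \<in> cont_linear" "L'' \<in> cont_linear" "T \<in> ?P"
        and B: "B = ?B L L' L'' T" by blast
      have "L - L' - L'' \<in> cont_linear" using L cont_linear_diff by blast
      then have "(L', conj_cut F L') + (L'', conj_cut (Ind C) L'') +
          (L - L' - L'', conj_cut (comp_bullet T G) (L - L' - L'')) \<in> ?\<Phi>"
        using L by (intro set_plus_intro) (auto simp: conj_cuts_def)
      then show "(L, B) \<in> ?\<Phi>" using B by (simp add: diff_diff_eq)
    qed
    show "L \<in> cont_linear" if "(L, B) \<in> ?\<Phi>" for L B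
      using that unfolding mem by blast
    show "beta3 K S F G C L y \<longleftrightarrow> (\<exists>B. (L, B) \<in> ?\<Phi> \<and> y \<notin> B)" if "L \<in> cont_linear" for L y
      unfolding beta3_def conjugate_eq_ext_rim[OF F] conjugate_eq_ext_rim[OF IC]
        conjugate_eq_ext_rim[OF TG]
        notin_cut_plus_plus_iff[OF cut_conj_cut[OF F] cut_conj_cut[OF IC] cut_conj_cut[OF TG]] mem
      using that by blast
  qed
  from 1 2 3 show ?thesis by blast
qed

end
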